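(* Let $\mathcal I$ be an index set, $\mathcal D$ a distribution over $\mathcal I$, and for $i\in\mathcal I$ let $f(\mathbf w;i)=\frac12\|\mathbf A_i\mathbf w-\mathbf b_i\|^2$ with $\mathbf A_i\in\mathbb R^{n_i\times d}$, $\mathbf b_i\in\mathbb R^{n_i}$. Let $\beta>0$ be such that $\|\mathbf A_i^\top\mathbf A_i\|\le\beta$ for all $i\in\mathcal I$, put $\bar f(\mathbf w)=\mathbb E_{i\sim\mathcal D}f(\mathbf w;i)$, and assume there is $\mathbf w_\star\in\mathbb R^d$ with $\bar f(\mathbf w_\star)=0$. Let $\mathbf w_0\in\mathbb R^d$ be arbitrary, $0<\eta<2/\beta$, and let $\mathbf w_{t+1}=\mathbf w_t-\eta\nabla f(\mathbf w_t;i_t)$ with $i_0,i_1,\dots$ i.i.d. from $\mathcal D$. Then, with $D=\|\mathbf w_0-\mathbf w_\star\|$, for all $T\ge1$, $$\mathbb E\,\bar f(\mathbf w_T)\le\frac{eD^2}{2\eta(2-\eta\beta)\,T^{\,1-\eta\beta(1-\eta\beta/4)}} .$$ In particular, for $\eta=1/\beta$, $\ \mathbb E\,\bar f(\mathbf w_T)\le\dfrac{e\beta D^2}{2\sqrt[4]{T}}$.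
   Context: $\|\cdot\|$ is the Euclidean norm for vectors and the spectral norm for matrices; $\nabla f(\mathbf w;i)$ is the gradient in $\mathbf w$. Expectations are over the sampled indices. *)

theory Defs
  imports "HOL-Probability.Probability"
begin

text \<open>
  The number of rows of the matrices varies with the index, so a matrix with \<open>m\<close> rows is
  a function \<open>A\<close> whose rows are \<open>A 0, \<dots>, A (m - 1)\<close>, and a vector with \<open>m\<close> entries is a
  function \<open>b\<close> with entries \<open>b 0, \<dots>, b (m - 1)\<close>; values at arguments from \<open>m\<close> on are ignored.
\<close>

definition least_squares :: "nat \<Rightarrow> (nat \<Rightarrow> real ^ 'd) \<Rightarrow> (nat \<Rightarrow> real) \<Rightarrow> real ^ 'd \<Rightarrow> real" where
  "least_squares m A b w = 1/2 * (L2_set (\<lambda>j. A j \<bullet> w - b j) {..<m})\<^sup>2"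

text \<open>The matrix \<open>A\<^sup>T A\<close>.\<close>

definition gram :: "nat \<Rightarrow> (nat \<Rightarrow> real ^ 'd) \<Rightarrow> real ^ 'd ^ 'd" where
  "gram m A = (\<chi> k l. \<Sum>j<m. A j $ k * A j $ l)"

text \<open>The type class norm on matrices is the Frobenius norm, hence the operator norm here.\<close>

definition spectral_norm :: "real ^ 'n ^ 'm \<Rightarrow> real" where
  "spectral_norm M = onorm ((*v) M)"

definition gradient :: "('a::real_inner \<Rightarrow> real) \<Rightarrow> 'a \<Rightarrow> 'a" where
  "gradient F x = (THE g. GDERIV F x :> g)"

primrec sgd :: "('a::real_inner \<Rightarrow> 'i \<Rightarrow> real) \<Rightarrow> real \<Rightarrow> 'a \<Rightarrow> (nat \<Rightarrow> 'i) \<Rightarrow> nat \<Rightarrow> 'a" where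
  "sgd f \<eta> w0 s 0 = w0"
| "sgd f \<eta> w0 s (Suc t) =
     sgd f \<eta> w0 s t - \<eta> *\<^sub>R gradient (\<lambda>w. f w (s t)) (sgd f \<eta> w0 s t)"

end

theory Submission
  imports Defs
begin

text \<open>
  Put \<open>\<gamma> = 1 - \<eta>\<beta>/2\<close>, so that the exponent of \<open>T\<close> is \<open>\<gamma>\<^sup>2\<close>. For a step from \<open>w\<close> to \<open>w'\<close> on index \<open>i\<close>
  and any reference point \<open>z\<close>, Young's inequality for \<open>\<langle>A\<^sub>i w - b\<^sub>i, A\<^sub>i z - b\<^sub>i\<rangle>\<close> with weight \<open>\<gamma>\<close> gives
  \<open>\<parallel>w' - z\<parallel>\<^sup>2 \<le> \<parallel>w - z\<parallel>\<^sup>2 - 2\<eta>\<gamma> f(w; i) + (2\<eta>/\<gamma>) f(z; i)\<close>.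
  Let \<open>x\<^sub>t\<close> be the expected loss of the \<open>t\<close>-th iterate. Taking the past iterate \<open>w\<^sub>s\<close> for \<open>z\<close> and
  summing over \<open>t = s, \<dots>, T\<close> yields \<open>\<gamma>\<^sup>2 (x\<^sub>s + \<dots> + x\<^sub>T) \<le> (T - s + 1) x\<^sub>s\<close>, which bounds \<open>x\<^sub>T\<close> by
  \<open>e T\<^bsup>-\<gamma>\<^sup>2\<^esup>\<close> times the sum of all losses; the minimizer as reference point bounds that sum by
  \<open>D\<^sup>2 / (4\<eta>\<gamma>)\<close>.
\<close>

section \<open>Least squares in one realization\<close>

text \<open>In matrix form this is \<open>A\<^sup>T (A w - b)\<close>, an explicit formula to
  replace the definite description \<open>gradient\<close>.\<close>

definition lsq_grad :: "nat \<Rightarrow> (nat \<Rightarrow> real ^ 'd) \<Rightarrow> (nat \<Rightarrow> real) \<Rightarrow> real ^ 'd \<Rightarrow> real ^ 'd" where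
  "lsq_grad m A b w = (\<Sum>j<m. (A j \<bullet> w - b j) *\<^sub>R A j)"

lemma least_squares_sum:
  "least_squares m A b w = 1/2 * (\<Sum>j<m. (A j \<bullet> w - b j)\<^sup>2)"
  by (simp add: least_squares_def L2_set_def sum_nonneg)

lemma least_squares_nonneg: "0 \<le> least_squares m A b w"
  by (simp add: least_squares_def)

lemma gradient_eqI:
  assumes "GDERIV F x :> g"
  shows "gradient F x = g"
  unfolding gradient_def
proof (rule the_equality)
  fix h assume "GDERIV F x :> h"
  then have "(\<lambda>v. v \<bullet> h) = (\<lambda>v. v \<bullet> g)"
    using assms unfolding gderiv_def by (rule has_derivative_unique)
  then show "h = g"
    by (metis inner_commute vector_eq_ldot)
qed (fact assms)

lemma gradient_least_squares: "gradient (least_squares m A b) w = lsq_grad m A b w"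
proof (rule gradient_eqI)
  have "((\<lambda>w. 1/2 * (\<Sum>j<m. (A j \<bullet> w - b j)\<^sup>2)) has_derivative (\<lambda>h. h \<bullet> lsq_grad m A b w)) (at w)"
    unfolding lsq_grad_def
    by (auto intro!: derivative_eq_intros
        simp: fun_eq_iff inner_sum_right sum_distrib_left inner_commute intro!: sum.cong)
  then show "GDERIV (least_squares m A b) w :> lsq_grad m A b w"
    unfolding gderiv_def by (simp add: least_squares_sum [abs_def])
qed

section \<open>Consequences of the spectral norm bound\<close>

lemma inner_gram: "x \<bullet> (gram m A *v x) = (\<Sum>j<m. (A j \<bullet> x)\<^sup>2)"
proof -
  have "x \<bullet> (gram m A *v x)
      = (\<Sum>k\<in>UNIV. \<Sum>l\<in>UNIV. \<Sum>j<m. (A j $ k * x $ k) * (A j $ l * x $ l))"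
    by (simp add: gram_def inner_vec_def matrix_vector_mult_def sum_distrib_left
        sum_distrib_right mult_ac)
  also have "\<dots> = (\<Sum>k\<in>UNIV. \<Sum>j<m. \<Sum>l\<in>UNIV. (A j $ k * x $ k) * (A j $ l * x $ l))"
    by (intro sum.cong refl sum.swap)
  also have "\<dots> = (\<Sum>j<m. \<Sum>k\<in>UNIV. \<Sum>l\<in>UNIV. (A j $ k * x $ k) * (A j $ l * x $ l))"
    by (rule sum.swap)
  also have "\<dots> = (\<Sum>j<m. (A j \<bullet> x)\<^sup>2)"
    by (simp add: inner_vec_def power2_eq_square sum_product)
  finally show ?thesis .
qed

text \<open>By Cauchy-Schwarz, the quadratic form of \<open>A\<^sup>T A\<close> at \<open>x\<close>
  is at most its operator norm times the squared norm of \<open>x\<close>.\<close>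

lemma sum_inner_le_gram:
  assumes "spectral_norm (gram m A) \<le> \<beta>"
  shows "(\<Sum>j<m. (A j \<bullet> x)\<^sup>2) \<le> \<beta> * (norm x)\<^sup>2"
proof -
  have "(\<Sum>j<m. (A j \<bullet> x)\<^sup>2) \<le> norm x * norm (gram m A *v x)"
    unfolding inner_gram [symmetric] by (rule norm_cauchy_schwarz)
  also have "\<dots> \<le> norm x * (spectral_norm (gram m A) * norm x)"
    unfolding spectral_norm_def
    by (intro mult_left_mono onorm matrix_vector_mul_bounded_linear) simp
  also have "\<dots> \<le> norm x * (\<beta> * norm x)"
    using assms by (intro mult_left_mono mult_right_mono) auto
  finally show ?thesis
    by (simp add: power2_eq_square mult_ac)
qed

text \<open>With residual \<open>r\<close>, the gradient is \<open>g = A\<^sup>T r\<close>, and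
  \<open>\<parallel>g\<parallel>\<^sup>2 = \<langle>r, A g\<rangle> \<le> \<parallel>r\<parallel> \<surd>\<beta> \<parallel>g\<parallel>\<close>.\<close>

lemma norm_lsq_grad_le:
  assumes "spectral_norm (gram m A) \<le> \<beta>"
  shows "(norm (lsq_grad m A b w))\<^sup>2 \<le> 2 * \<beta> * least_squares m A b w"
proof -
  let ?g = "lsq_grad m A b w" and ?R = "\<Sum>j<m. (A j \<bullet> w - b j)\<^sup>2"
  have "(norm ?g)\<^sup>2 = ?g \<bullet> (\<Sum>j<m. (A j \<bullet> w - b j) *\<^sub>R A j)"
    by (simp add: power2_norm_eq_inner lsq_grad_def)
  also have "\<dots> = (\<Sum>j<m. (A j \<bullet> w - b j) * (A j \<bullet> ?g))"
    by (simp add: inner_sum_right inner_commute)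
  finally have "((norm ?g)\<^sup>2)\<^sup>2 \<le> ?R * (\<Sum>j<m. (A j \<bullet> ?g)\<^sup>2)"
    using Cauchy_Schwarz_ineq_sum by metis
  also have "\<dots> \<le> ?R * (\<beta> * (norm ?g)\<^sup>2)"
    by (intro mult_left_mono sum_nonneg sum_inner_le_gram assms) auto
  finally have "(norm ?g)\<^sup>2 * (norm ?g)\<^sup>2 \<le> (?R * \<beta>) * (norm ?g)\<^sup>2"
    by (simp add: power2_eq_square mult_ac)
  moreover have "0 \<le> \<beta>"
    using assms unfolding spectral_norm_def
    by (meson matrix_vector_mul_bounded_linear onorm_pos_le order_trans)
  ultimately have "(norm ?g)\<^sup>2 \<le> ?R * \<beta>"
    by (cases "?g = 0") (auto simp: sum_nonneg intro: mult_right_le_imp_le [of _ "(norm ?g)\<^sup>2"])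
  then show ?thesis
    by (simp add: least_squares_sum mult_ac)
qed

section \<open>Progress of a single gradient step\<close>

lemma lsq_grad_inner_diff:
  "lsq_grad m A b w \<bullet> (w - z) = (\<Sum>j<m. (A j \<bullet> w - b j) * ((A j \<bullet> w - b j) - (A j \<bullet> z - b j)))"
  by (simp add: lsq_grad_def inner_sum_left) (simp add: inner_diff_right)

text \<open>Expand the square around \<open>z\<close>. Young's inequality bounds the cross term from
  below, and the squared gradient is controlled by the loss at \<open>w\<close>; so \<open>z\<close>
  may have positive loss.\<close>

lemma least_squares_step:
  assumes S: "spectral_norm (gram m A) \<le> \<beta>" and \<eta>: "0 < \<eta>" and \<gamma>: "\<gamma> = 1 - \<eta> * \<beta> / 2" "0 < \<gamma>"
  shows "(norm (w - \<eta> *\<^sub>R lsq_grad m A b w - z))\<^sup>2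
    \<le> (norm (w - z))\<^sup>2 - 2 * \<eta> * \<gamma> * least_squares m A b w + 2 * \<eta> / \<gamma> * least_squares m A b z"
proof -
  let ?r = "\<lambda>v j. A j \<bullet> v - b j" and ?g = "lsq_grad m A b w" and ?f = "least_squares m A b"
  have young: "2 * x * y \<le> \<gamma> * x\<^sup>2 + y\<^sup>2 / \<gamma>" for x y :: real
  proof -
    have "\<gamma> * x\<^sup>2 + y\<^sup>2 / \<gamma> - 2 * x * y = (\<gamma> * x - y)\<^sup>2 / \<gamma>"
      using \<gamma>(2) by (simp add: field_simps power2_eq_square)
    also have "\<dots> \<ge> 0"
      using \<gamma>(2) by simp
    finally show ?thesis by simp
  qed
  have "(2 - \<gamma>) * (?r w j)\<^sup>2 - (?r z j)\<^sup>2 / \<gamma> \<le> 2 * (?r w j * (?r w j - ?r z j))" for j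
    using young [of "?r w j" "?r z j"] by (simp add: algebra_simps power2_eq_square)
  then have "(\<Sum>j<m. (2 - \<gamma>) * (?r w j)\<^sup>2 - (?r z j)\<^sup>2 / \<gamma>) \<le> 2 * (?g \<bullet> (w - z))"
    unfolding lsq_grad_inner_diff sum_distrib_left by (intro sum_mono)
  then have inner: "(2 - \<gamma>) * (2 * ?f w) - 2 * ?f z / \<gamma> \<le> 2 * (?g \<bullet> (w - z))"
    by (simp add: least_squares_sum sum_subtractf sum_distrib_left sum_divide_distrib)
  have "(norm (w - \<eta> *\<^sub>R ?g - z))\<^sup>2
      = (norm (w - z))\<^sup>2 - \<eta> * (2 * (?g \<bullet> (w - z))) + \<eta>\<^sup>2 * (norm ?g)\<^sup>2"
    unfolding power2_norm_eq_inner
    by (simp add: inner_diff_left inner_diff_right inner_commute algebra_simps power2_eq_square)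
  also have "\<dots> \<le> (norm (w - z))\<^sup>2 - \<eta> * ((2 - \<gamma>) * (2 * ?f w) - 2 * ?f z / \<gamma>)
      + \<eta>\<^sup>2 * (2 * \<beta> * ?f w)"
    using \<eta> norm_lsq_grad_le [OF S, of b w] inner
    by (intro add_mono diff_mono mult_left_mono) auto
  \<comment> \<open>Since \<open>\<eta> \<beta> = 2 (1 - \<gamma>)\<close>, the coefficient
    \<open>-2 \<eta> (2 - \<gamma>) + 2 \<eta>^2 \<beta>\<close> of the loss at \<open>w\<close>
    collapses to \<open>-2 \<eta> \<gamma>\<close>.\<close>
  also have "\<dots> = (norm (w - z))\<^sup>2 - 2 * \<eta> * \<gamma> * ?f w + 2 * \<eta> / \<gamma> * ?f z"
    unfolding \<gamma>(1) by (simp add: algebra_simps power2_eq_square)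
  finally show ?thesis .
qed

lemma least_squares_eq_0D:
  assumes "least_squares m A b z = 0" "j < m"
  shows "A j \<bullet> z = b j"
proof -
  have "(\<Sum>j<m. (A j \<bullet> z - b j)\<^sup>2) = 0"
    using assms(1) by (simp add: least_squares_sum)
  then show ?thesis
    using assms(2) by (simp add: sum_nonneg_eq_0_iff)
qed

text \<open>All residuals vanish at \<open>z\<close>, so the cross term is known exactly. Without
  the loss from Young's inequality, the decrease doubles from \<open>2 \<eta> \<gamma>\<close> to
  \<open>4 \<eta> \<gamma>\<close> times the loss.\<close>

lemma least_squares_step_minimizer:
  assumes S: "spectral_norm (gram m A) \<le> \<beta>" and \<eta>: "0 < \<eta>" and \<gamma>: "\<gamma> = 1 - \<eta> * \<beta> / 2"
    and z: "least_squares m A b z = 0"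
  shows "(norm (w - \<eta> *\<^sub>R lsq_grad m A b w - z))\<^sup>2
    \<le> (norm (w - z))\<^sup>2 - 4 * \<eta> * \<gamma> * least_squares m A b w"
proof -
  let ?g = "lsq_grad m A b w" and ?f = "least_squares m A b"
  have inner: "?g \<bullet> (w - z) = 2 * ?f w"
    unfolding lsq_grad_inner_diff least_squares_sum
    by (simp add: least_squares_eq_0D [OF z] power2_eq_square)
  have "(norm (w - \<eta> *\<^sub>R ?g - z))\<^sup>2
      = (norm (w - z))\<^sup>2 - \<eta> * (2 * (?g \<bullet> (w - z))) + \<eta>\<^sup>2 * (norm ?g)\<^sup>2"
    unfolding power2_norm_eq_inner
    by (simp add: inner_diff_left inner_diff_right inner_commute algebra_simps power2_eq_square)
  also have "\<dots> \<le> (norm (w - z))\<^sup>2 - \<eta> * (2 * (2 * ?f w)) + \<eta>\<^sup>2 * (2 * \<beta> * ?f w)"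
    unfolding inner using norm_lsq_grad_le [OF S, of b w]
    by (intro add_mono mult_left_mono) auto
  also have "\<dots> = (norm (w - z))\<^sup>2 - 4 * \<eta> * \<gamma> * ?f w"
    unfolding \<gamma> by (simp add: algebra_simps power2_eq_square)
  finally show ?thesis .
qed

text \<open>The residual at \<open>w\<close> is \<open>A (w - z)\<close>. This turns bounded
  iterates into bounded, hence integrable, losses.\<close>

lemma least_squares_le_dist_minimizer:
  assumes S: "spectral_norm (gram m A) \<le> \<beta>" and z: "least_squares m A b z = 0"
  shows "least_squares m A b w \<le> \<beta> / 2 * (norm (w - z))\<^sup>2"
proof -
  have "least_squares m A b w = 1/2 * (\<Sum>j<m. (A j \<bullet> (w - z))\<^sup>2)"
    by (simp add: least_squares_sum inner_diff_right least_squares_eq_0D [OF z])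
  also have "\<dots> \<le> 1/2 * (\<beta> * (norm (w - z))\<^sup>2)"
    by (intro mult_left_mono sum_inner_le_gram S) auto
  finally show ?thesis by simp
qed

lemma lsq_grad_nth:
  "lsq_grad m A b w $ k
    = (least_squares m A b (w + axis k 1) - least_squares m A b (w - axis k 1)) / 2"
  unfolding least_squares_sum right_diff_distrib [symmetric] sum_subtractf [symmetric]
    sum_distrib_left sum_divide_distrib
  by (simp add: lsq_grad_def sum_divide_distrib, rule sum.cong)
     (auto simp: inner_add_right inner_diff_right inner_axis field_simps power2_eq_square)

text \<open>The gradient is affine in \<open>w\<close>, so its values at the origin and the unit
  vectors determine it. This separates \<open>w\<close> from the index when joint measurability is
  proved.\<close>

lemma lsq_grad_affine:
  "lsq_grad m A b w = lsq_grad m A b 0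
    + (\<Sum>k\<in>UNIV. w $ k *\<^sub>R (lsq_grad m A b (axis k 1) - lsq_grad m A b 0))"
proof -
  have *: "lsq_grad m A b v - lsq_grad m A b 0 = (\<Sum>j<m. (A j \<bullet> v) *\<^sub>R A j)" for v
    by (simp add: lsq_grad_def scaleR_left_diff_distrib flip: sum_subtractf)
  have "(\<Sum>k\<in>UNIV. w $ k *\<^sub>R (\<Sum>j<m. (A j \<bullet> axis k 1) *\<^sub>R A j))
      = (\<Sum>j<m. (\<Sum>k\<in>UNIV. A j $ k * w $ k) *\<^sub>R A j)"
    by (simp add: scaleR_sum_right scaleR_sum_left inner_axis mult.commute, rule sum.swap)
  also have "\<dots> = (\<Sum>j<m. (A j \<bullet> w) *\<^sub>R A j)"
    by (simp add: inner_vec_def)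
  finally have sum: "(\<Sum>k\<in>UNIV. w $ k *\<^sub>R (\<Sum>j<m. (A j \<bullet> axis k 1) *\<^sub>R A j)) = \<dots>" .
  have "lsq_grad m A b w = lsq_grad m A b 0 + (\<Sum>j<m. (A j \<bullet> w) *\<^sub>R A j)"
    unfolding * [symmetric] by simp
  then show ?thesis
    unfolding * sum .
qed

text \<open>The trapezoidal rule along the segment from 0 to \<open>w\<close> is exact because the
  gradient is affine.\<close>

lemma least_squares_eq_lsq_grad:
  "least_squares m A b w
    = least_squares m A b 0 + 1/2 * ((lsq_grad m A b 0 + lsq_grad m A b w) \<bullet> w)"
  unfolding least_squares_sum lsq_grad_def inner_sum_left inner_add_left inner_scaleR_left
    sum.distrib [symmetric] sum_distrib_left
  by (rule sum.cong) (auto simp: field_simps power2_eq_square)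

section \<open>A scalar recursion\<close>

text \<open>Since \<open>1 - c \<le> exp (- c)\<close> with \<open>c = a / (k + 1)\<close>, passing from \<open>k - 1\<close> to \<open>k\<close> multiplies
  the partial sum by at least \<open>exp c \<ge> ((k + 2) / (k + 1)) powr a\<close>.\<close>

lemma partial_sum_growth:
  fixes y :: "nat \<Rightarrow> real"
  assumes a: "0 \<le> a" "a \<le> 1" and y: "\<And>k. 0 \<le> y k"
    and rec: "\<And>k. k \<le> N \<Longrightarrow> a * (\<Sum>j\<le>k. y j) \<le> real (Suc k) * y k"
    and "k \<le> N"
  shows "(real (k + 2) / 2) powr a * y 0 \<le> (\<Sum>j\<le>k. y j)"
  using \<open>k \<le> N\<close>
proof (induction k)
  case (Suc k)
  let ?S = "\<lambda>k. \<Sum>j\<le>k. y j" and ?c = "a / real (k + 2)"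
  have "?c * ?S (Suc k) \<le> y (Suc k)"
    using rec [OF Suc.prems] by (simp add: field_simps)
  then have "?S k \<le> (1 - ?c) * ?S (Suc k)"
    by (simp add: algebra_simps)
  also have "\<dots> \<le> exp (- ?c) * ?S (Suc k)"
    using exp_ge_add_one_self [of "- ?c"] by (intro mult_right_mono sum_nonneg y) auto
  finally have S: "exp ?c * ?S k \<le> ?S (Suc k)"
    by (simp add: exp_minus field_simps)
  have "real (k + 3) / real (k + 2) \<le> exp (1 / real (k + 2))"
    using exp_ge_add_one_self [of "1 / real (k + 2)"] by (simp add: field_simps)
  then have "(real (k + 3) / real (k + 2)) powr a \<le> exp (1 / real (k + 2)) powr a"
    using a by (intro powr_mono2) auto
  also have "\<dots> = exp ?c"
    by (simp add: powr_def)
  finally have e: "(real (k + 3) / real (k + 2)) powr a \<le> exp ?c" .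
  have "(real (Suc k + 2) / 2) powr a * y 0
      = (real (k + 3) / real (k + 2)) powr a * ((real (k + 2) / 2) powr a * y 0)"
    by (simp add: powr_divide powr_mult field_simps del: of_nat_add of_nat_Suc)
       (simp add: eval_nat_numeral)
  also have "\<dots> \<le> exp ?c * ?S k"
    using e Suc y by (intro mult_mono) auto
  finally show ?case
    using S by linarith
qed simp

text \<open>Time is reversed: with \<open>y j = x (T - j)\<close>, suffix sums become partial sums
  and the last term becomes the first, so that \<open>partial_sum_growth\<close> applies.\<close>

lemma last_le_sum:
  fixes x :: "nat \<Rightarrow> real"
  assumes a: "0 \<le> a" "a \<le> 1" and x: "\<And>t. 0 \<le> x t" and "T \<ge> 1"
    and suffix: "\<And>s. s \<le> T \<Longrightarrow> a * (\<Sum>t=s..T. x t) \<le> real (Suc (T - s)) * x s"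
  shows "x T \<le> exp 1 * (\<Sum>t\<le>T. x t) / real T powr a"
proof -
  have rev: "(\<Sum>j\<le>k. x (T - j)) = (\<Sum>t=T-k..T. x t)" if "k \<le> T" for k
    using that by (intro sum.reindex_bij_witness [of _ "\<lambda>t. T - t" "\<lambda>j. T - j"]) auto
  have "a * (\<Sum>j\<le>k. x (T - j)) \<le> real (Suc k) * x (T - k)" if "k \<le> T" for k
    using suffix [of "T - k"] that by (simp add: rev del: of_nat_Suc)
  then have "(real (T + 2) / 2) powr a * x (T - 0) \<le> (\<Sum>j\<le>T. x (T - j))"
    by (intro partial_sum_growth [where y = "\<lambda>j. x (T - j)" and N = T] a x) auto
  then have *: "(real (T + 2) / 2) powr a * x T \<le> (\<Sum>t\<le>T. x t)"
    by (simp add: rev atLeast0AtMost)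
  \<comment> \<open>The denominator 2 in the growth bound costs a factor \<open>2 powr a\<close>, at
    most 2; this is where the constant \<open>exp 1\<close> enters.\<close>
  have "2 powr a \<le> 2 powr (1::real)"
    using a by (intro powr_mono) auto
  also have "\<dots> \<le> exp 1"
    using exp_ge_add_one_self [of "1::real"] by simp
  finally have two: "2 powr a \<le> exp (1::real)" .
  have "real T powr a * x T \<le> real (T + 2) powr a * x T"
    using a x by (intro mult_right_mono powr_mono2) auto
  also have "\<dots> = 2 powr a * ((real (T + 2) / 2) powr a * x T)"
    by (simp add: powr_divide)
  also have "\<dots> \<le> exp 1 * (\<Sum>t\<le>T. x t)"
    using two * x by (intro mult_mono) auto
  finally show ?thesis
    using \<open>T \<ge> 1\<close> by (simp add: field_simps)
qed

section \<open>Stochastic gradient descent\<close>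

text \<open>Independence makes the joint law a product, so Fubini applies: \<open>X\<close> is
  frozen while \<open>Y\<close> is averaged. This takes the place of conditioning on the
  past.\<close>

lemma (in prob_space) indep_var_integral_Pair:
  fixes h :: "_ \<Rightarrow> real"
  assumes "indep_var S X N Y" and h [measurable]: "h \<in> borel_measurable (S \<Otimes>\<^sub>M N)"
    and int: "integrable M (\<lambda>\<omega>. h (X \<omega>, Y \<omega>))"
  shows "(\<integral>\<omega>. h (X \<omega>, Y \<omega>) \<partial>M) = (\<integral>\<omega>. (\<integral>\<omega>'. h (X \<omega>, Y \<omega>') \<partial>M) \<partial>M)"
proof -
  have [measurable]: "X \<in> M \<rightarrow>\<^sub>M S" "Y \<in> M \<rightarrow>\<^sub>M N"
    and eq: "distr M S X \<Otimes>\<^sub>M distr M N Y = distr M (S \<Otimes>\<^sub>M N) (\<lambda>\<omega>. (X \<omega>, Y \<omega>))"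
    using assms(1) unfolding indep_var_distribution_eq by auto
  interpret X: prob_space "distr M S X" by (rule prob_space_distr) measurable
  interpret Y: prob_space "distr M N Y" by (rule prob_space_distr) measurable
  interpret XY: pair_sigma_finite "distr M S X" "distr M N Y" ..
  have "(\<integral>\<omega>. h (X \<omega>, Y \<omega>) \<partial>M) = (\<integral>p. h p \<partial>(distr M S X \<Otimes>\<^sub>M distr M N Y))"
    unfolding eq by (rule integral_distr [symmetric]) measurable
  also have "\<dots> = (\<integral>x. (\<integral>y. h (x, y) \<partial>distr M N Y) \<partial>distr M S X)"
    using int by (intro XY.integral_fst' [symmetric]) (simp add: eq integrable_distr_eq)
  also have "\<dots> = (\<integral>\<omega>. (\<integral>y. h (X \<omega>, y) \<partial>distr M N Y) \<partial>M)"
    by (rule integral_distr) measurable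
  also have "\<dots> = (\<integral>\<omega>. (\<integral>\<omega>'. h (X \<omega>, Y \<omega>') \<partial>M) \<partial>M)"
  proof (rule Bochner_Integration.integral_cong [OF refl])
    fix \<omega> assume "\<omega> \<in> space M"
    then have [measurable]: "X \<omega> \<in> space S"
      using measurable_space [of X M S] by simp
    show "(\<integral>y. h (X \<omega>, y) \<partial>distr M N Y) = (\<integral>\<omega>'. h (X \<omega>, Y \<omega>') \<partial>M)"
      by (rule integral_distr) measurable
  qed
  finally show ?thesis .
qed

text \<open>An iterate depends only on the indices drawn before it; its independence of later draws
  rests on this.\<close>

lemma sgd_cong:
  assumes "\<And>u. u < t \<Longrightarrow> s u = s' u"
  shows "sgd f \<eta> w0 s t = sgd f \<eta> w0 s' t"
  using assms by (induction t) auto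

locale least_squares_sgd = P: prob_space P + D: prob_space \<D>
  for P :: "'\<omega> measure" and \<D> :: "'i measure" +
  fixes n :: "'i \<Rightarrow> nat"
    and A :: "'i \<Rightarrow> nat \<Rightarrow> real ^ 'd"
    and b :: "'i \<Rightarrow> nat \<Rightarrow> real"
    and \<beta> \<eta> :: real
    and w0 w_star :: "real ^ 'd"
    and ind :: "nat \<Rightarrow> '\<omega> \<Rightarrow> 'i"
  assumes beta_pos: "0 < \<beta>"
    and spectral: "\<And>i. i \<in> space \<D> \<Longrightarrow> spectral_norm (gram (n i) (A i)) \<le> \<beta>"
    and int_lsq: "\<And>w. integrable \<D> (\<lambda>i. least_squares (n i) (A i) (b i) w)"
    and minimizer: "(\<integral>i. least_squares (n i) (A i) (b i) w_star \<partial>\<D>) = 0"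
    and indep: "P.indep_vars (\<lambda>_. \<D>) ind UNIV"
    and distr_ind: "\<And>t. distr P \<D> (ind t) = \<D>"
    and eta: "0 < \<eta>" "\<eta> < 2 / \<beta>"
begin

definition f :: "real ^ 'd \<Rightarrow> 'i \<Rightarrow> real" where
  "f w i = least_squares (n i) (A i) (b i) w"

definition g :: "real ^ 'd \<Rightarrow> 'i \<Rightarrow> real ^ 'd" where
  "g w i = lsq_grad (n i) (A i) (b i) w"

definition F :: "real ^ 'd \<Rightarrow> real" where
  "F w = (\<integral>i. f w i \<partial>\<D>)"

definition W :: "nat \<Rightarrow> '\<omega> \<Rightarrow> real ^ 'd" where
  "W t \<omega> = sgd f \<eta> w0 (\<lambda>t. ind t \<omega>) t"

definition \<gamma> :: real where
  "\<gamma> = 1 - \<eta> * \<beta> / 2"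

lemma gamma_pos: "0 < \<gamma>" and gamma_le_1: "\<gamma> \<le> 1"
  using eta beta_pos by (auto simp: \<gamma>_def field_simps)

lemma f_nonneg: "0 \<le> f w i"
  by (simp add: f_def least_squares_nonneg)

lemma gradient_f: "gradient (\<lambda>w. f w i) w = g w i"
  by (simp add: f_def g_def gradient_least_squares [symmetric])

lemma sgd_Suc': "sgd f \<eta> w0 s (Suc t) = sgd f \<eta> w0 s t - \<eta> *\<^sub>R g (sgd f \<eta> w0 s t) (s t)"
  by (simp add: gradient_f)

lemma W_Suc: "W (Suc t) \<omega> = W t \<omega> - \<eta> *\<^sub>R g (W t \<omega>) (ind t \<omega>)"
  unfolding W_def by (rule sgd_Suc')

section \<open>Measurability of losses, gradients and iterates\<close>

lemma measurable_f_fixed [measurable]: "f w \<in> borel_measurable \<D>"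
  using int_lsq [of w] by (auto simp: f_def [abs_def])

text \<open>The rows of \<open>A i\<close> need not be measurable in \<open>i\<close>, but \<open>f w i\<close> is, and central differences
  recover from it the coefficients of the quadratic polynomial \<open>\<lambda>w. f w i\<close>.\<close>

lemma measurable_g_fixed [measurable]: "g w \<in> borel_measurable \<D>"
proof -
  have "(\<lambda>i. \<Sum>k\<in>UNIV. ((f (w + axis k 1) i - f (w - axis k 1) i) / 2) *\<^sub>R axis k (1::real))
      \<in> borel_measurable \<D>"
    by measurable
  also have "(\<lambda>i. \<Sum>k\<in>UNIV. ((f (w + axis k 1) i - f (w - axis k 1) i) / 2) *\<^sub>R axis k (1::real)) = g w"
    by (simp add: fun_eq_iff vec_eq_iff g_def f_def lsq_grad_nth axis_def if_distrib sum.delta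
        cong: if_cong)
  finally show ?thesis .
qed

text \<open>Iterates are random, so joint measurability is required. The affine formula writes
  \<open>g\<close> as a finite combination of coordinates of \<open>w\<close> and functions of
  \<open>i\<close> alone.\<close>

lemma measurable_g [measurable]: "(\<lambda>(w, i). g w i) \<in> borel_measurable (borel \<Otimes>\<^sub>M \<D>)"
proof -
  have [measurable]: "(\<lambda>p. g v (snd p)) \<in> borel_measurable ((borel :: (real ^ 'd) measure) \<Otimes>\<^sub>M \<D>)" for v
    by (rule measurable_compose [OF measurable_snd measurable_g_fixed])
  have "(\<lambda>p. g 0 (snd p) + (\<Sum>k\<in>UNIV. (fst p \<bullet> axis k (1::real)) *\<^sub>R (g (axis k 1) (snd p) - g 0 (snd p))))
      \<in> borel_measurable (borel \<Otimes>\<^sub>M \<D>)"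
    by measurable
  also have "(\<lambda>p. g 0 (snd p) + (\<Sum>k\<in>UNIV. (fst p \<bullet> axis k (1::real)) *\<^sub>R (g (axis k 1) (snd p) - g 0 (snd p))))
      = (\<lambda>(w, i). g w i)"
    unfolding g_def case_prod_unfold
    by (rule ext) (simp only: inner_axis inner_real_def mult_1_right lsq_grad_affine [symmetric])
  finally show ?thesis .
qed

lemma measurable_f [measurable]: "(\<lambda>(w, i). f w i) \<in> borel_measurable (borel \<Otimes>\<^sub>M \<D>)"
proof -
  have "(\<lambda>(w, i). f 0 i + 1/2 * ((g 0 i + g w i) \<bullet> w)) \<in> borel_measurable (borel \<Otimes>\<^sub>M \<D>)"
    by measurable
  then show ?thesis
    unfolding f_def g_def least_squares_eq_lsq_grad [symmetric] .
qed

lemma measurable_F [measurable]: "F \<in> borel_measurable borel"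
  unfolding F_def by measurable

lemma measurable_ind [measurable]: "ind t \<in> P \<rightarrow>\<^sub>M \<D>"
  using indep by (auto simp: P.indep_vars_def)

text \<open>The product runs over all indices before \<open>t\<close>, not just before
  \<open>s\<close>, so that a past iterate and the fresh index \<open>t\<close> live on disjoint
  coordinates.\<close>

lemma measurable_sgd: "s \<le> t \<Longrightarrow> (\<lambda>x. sgd f \<eta> w0 x s) \<in> borel_measurable (PiM {..<t} (\<lambda>_. \<D>))"
proof (induction s)
  case (Suc s)
  have [measurable]: "(\<lambda>x. sgd f \<eta> w0 x s) \<in> borel_measurable (PiM {..<t} (\<lambda>_. \<D>))"
    using Suc by simp
  have [measurable]: "(\<lambda>x. x s) \<in> PiM {..<t} (\<lambda>_. \<D>) \<rightarrow>\<^sub>M \<D>"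
    using Suc.prems by (intro measurable_component_singleton) simp
  show ?case
    unfolding sgd_Suc' by measurable
qed simp

lemma W_restrict: "s \<le> t \<Longrightarrow> W s \<omega> = sgd f \<eta> w0 (\<lambda>u\<in>{..<t}. ind u \<omega>) s"
  unfolding W_def by (rule sgd_cong) auto

lemma measurable_W [measurable]: "W t \<in> borel_measurable P"
proof -
  have "(\<lambda>\<omega>. \<lambda>u\<in>{..<t}. ind u \<omega>) \<in> P \<rightarrow>\<^sub>M PiM {..<t} (\<lambda>_. \<D>)"
    by (rule measurable_restrict) measurable
  then have "(\<lambda>\<omega>. sgd f \<eta> w0 (\<lambda>u\<in>{..<t}. ind u \<omega>) t) \<in> borel_measurable P"
    by (rule measurable_compose) (rule measurable_sgd [OF order_refl])
  then show ?thesis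
    unfolding W_restrict [OF order_refl, symmetric] .
qed

section \<open>Almost sure bounds and integrability\<close>

lemma AE_f_minimizer: "AE i in \<D>. f w_star i = 0"
  using minimizer integral_nonneg_eq_0_iff_AE [OF int_lsq [of w_star]]
  by (simp add: f_def least_squares_nonneg)

lemma AE_interpolation: "AE \<omega> in P. \<forall>t. f w_star (ind t \<omega>) = 0"
  unfolding AE_all_countable
proof
  fix t
  have "AE i in distr P \<D> (ind t). f w_star i = 0"
    unfolding distr_ind by (rule AE_f_minimizer)
  then show "AE \<omega> in P. f w_star (ind t \<omega>) = 0"
    by (rule AE_distrD [OF measurable_ind])
qed

lemma step_minimizer:
  assumes "f w_star i = 0" "i \<in> space \<D>"
  shows "(norm (w - \<eta> *\<^sub>R g w i - w_star))\<^sup>2 \<le> (norm (w - w_star))\<^sup>2 - 4 * \<eta> * \<gamma> * f w i"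
  using assms eta spectral unfolding f_def g_def
  by (intro least_squares_step_minimizer [OF _ _ \<gamma>_def]) auto

text \<open>When every sampled loss vanishes at \<open>w_star\<close>, no step increases the
  distance to it. The integrability of losses and distances along the iterates rests on this
  bound.\<close>

lemma AE_W_bounded: "AE \<omega> in P. \<forall>t. norm (W t \<omega> - w_star) \<le> norm (w0 - w_star)"
  using AE_interpolation AE_space
proof eventually_elim
  case (elim \<omega>)
  show ?case
  proof
    fix t
    show "norm (W t \<omega> - w_star) \<le> norm (w0 - w_star)"
    proof (induction t)
      case (Suc t)
      have "(norm (W (Suc t) \<omega> - w_star))\<^sup>2
          \<le> (norm (W t \<omega> - w_star))\<^sup>2 - 4 * \<eta> * \<gamma> * f (W t \<omega>) (ind t \<omega>)"
        unfolding W_Suc using elim measurable_space [OF measurable_ind]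
        by (intro step_minimizer) auto
      also have "\<dots> \<le> (norm (W t \<omega> - w_star))\<^sup>2"
        using eta gamma_pos f_nonneg by simp
      finally show ?case
        using Suc by (meson norm_ge_zero order_trans power2_le_imp_le)
    qed (simp add: W_def)
  qed
qed

lemma f_le_dist:
  assumes "f w_star i = 0" "i \<in> space \<D>"
  shows "f w i \<le> \<beta> / 2 * (norm (w - w_star))\<^sup>2"
  using assms spectral unfolding f_def by (intro least_squares_le_dist_minimizer) auto

lemma F_nonneg: "0 \<le> F w"
  unfolding F_def by (simp add: f_nonneg)

lemma F_le_dist: "F w \<le> \<beta> / 2 * (norm (w - w_star))\<^sup>2"
proof -
  have "F w \<le> (\<integral>i. \<beta> / 2 * (norm (w - w_star))\<^sup>2 \<partial>\<D>)"
    unfolding F_def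
  proof (rule integral_mono_AE)
    show "AE i in \<D>. f w i \<le> \<beta> / 2 * (norm (w - w_star))\<^sup>2"
      using AE_f_minimizer AE_space by eventually_elim (rule f_le_dist)
  qed (simp_all add: f_def [abs_def] int_lsq)
  then show ?thesis by (simp add: D.prob_space)
qed

lemma integrable_F_W: "integrable P (\<lambda>\<omega>. F (W t \<omega>))"
proof (rule P.integrable_const_bound)
  show "AE \<omega> in P. norm (F (W t \<omega>)) \<le> \<beta> / 2 * (norm (w0 - w_star))\<^sup>2"
    using AE_W_bounded
  proof eventually_elim
    case (elim \<omega>)
    have "F (W t \<omega>) \<le> \<beta> / 2 * (norm (W t \<omega> - w_star))\<^sup>2"
      by (rule F_le_dist)
    also have "\<dots> \<le> \<beta> / 2 * (norm (w0 - w_star))\<^sup>2"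
      using elim beta_pos by (intro mult_left_mono power_mono) auto
    finally show ?case by (simp add: F_nonneg)
  qed
qed measurable

lemma integrable_f_W: "integrable P (\<lambda>\<omega>. f (W s \<omega>) (ind t \<omega>))"
proof (rule P.integrable_const_bound)
  show "AE \<omega> in P. norm (f (W s \<omega>) (ind t \<omega>)) \<le> \<beta> / 2 * (norm (w0 - w_star))\<^sup>2"
    using AE_W_bounded AE_interpolation AE_space
  proof eventually_elim
    case (elim \<omega>)
    have "f (W s \<omega>) (ind t \<omega>) \<le> \<beta> / 2 * (norm (W s \<omega> - w_star))\<^sup>2"
      using elim measurable_space [OF measurable_ind] by (intro f_le_dist) auto
    also have "\<dots> \<le> \<beta> / 2 * (norm (w0 - w_star))\<^sup>2"
      using elim beta_pos by (intro mult_left_mono power_mono) auto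
    finally show ?case by (simp add: f_nonneg)
  qed
qed measurable

text \<open>\<open>Z\<close> stands for either reference point: a past iterate or the constant
  \<open>w_star\<close>.\<close>

lemma integrable_dist_W:
  assumes [measurable]: "Z \<in> borel_measurable P"
    and Z: "AE \<omega> in P. norm (Z \<omega> - w_star) \<le> norm (w0 - w_star)"
  shows "integrable P (\<lambda>\<omega>. (norm (W t \<omega> - Z \<omega>))\<^sup>2)"
proof (rule P.integrable_const_bound)
  show "AE \<omega> in P. norm ((norm (W t \<omega> - Z \<omega>))\<^sup>2) \<le> (2 * norm (w0 - w_star))\<^sup>2"
    using AE_W_bounded Z
  proof eventually_elim
    case (elim \<omega>)
    have "norm (W t \<omega> - Z \<omega>) \<le> norm (W t \<omega> - w_star) + norm (Z \<omega> - w_star)"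
      by (metis norm_triangle_ineq4 diff_diff_eq2 diff_add_cancel)
    also have "\<dots> \<le> 2 * norm (w0 - w_star)"
      using elim(1) [rule_format, of t] elim(2) by linarith
    finally show ?case
      unfolding norm_power by (intro power_mono) auto
  qed
qed measurable

text \<open>\<open>ind t\<close> is independent of \<open>W s\<close>, so averaging over it turns
  the sampled loss into \<open>F\<close>. The case \<open>s = t\<close> serves the current iterate,
  \<open>s < t\<close> the reference point.\<close>

lemma expectation_f_W:
  assumes "s \<le> t"
  shows "(\<integral>\<omega>. f (W s \<omega>) (ind t \<omega>) \<partial>P) = (\<integral>\<omega>. F (W s \<omega>) \<partial>P)"
proof -
  let ?X = "\<lambda>\<omega>. \<lambda>u\<in>{..<t}. ind u \<omega>" and ?Y = "\<lambda>\<omega>. \<lambda>u\<in>{t}. ind u \<omega>"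
  let ?h = "\<lambda>p. f (sgd f \<eta> w0 (fst p) s) (snd p t)"
  have h: "?h (?X \<omega>, ?Y \<omega>') = f (W s \<omega>) (ind t \<omega>')" for \<omega> \<omega>'
    using assms by (simp add: W_restrict)
  have [measurable]: "(\<lambda>x. sgd f \<eta> w0 x s) \<in> borel_measurable (PiM {..<t} (\<lambda>_. \<D>))"
    using assms by (rule measurable_sgd)
  have [measurable]: "(\<lambda>y. y t) \<in> PiM {t} (\<lambda>_. \<D>) \<rightarrow>\<^sub>M \<D>"
    by (rule measurable_component_singleton) simp
  have "P.indep_var (PiM {..<t} (\<lambda>_. \<D>)) ?X (PiM {t} (\<lambda>_. \<D>)) ?Y"
    by (rule P.indep_var_restrict [OF indep]) auto
  moreover have "?h \<in> borel_measurable (PiM {..<t} (\<lambda>_. \<D>) \<Otimes>\<^sub>M PiM {t} (\<lambda>_. \<D>))"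
    by measurable
  ultimately have "(\<integral>\<omega>. f (W s \<omega>) (ind t \<omega>) \<partial>P) = (\<integral>\<omega>. (\<integral>\<omega>'. f (W s \<omega>) (ind t \<omega>') \<partial>P) \<partial>P)"
    using P.indep_var_integral_Pair [of _ ?X _ ?Y ?h] integrable_f_W unfolding h by blast
  moreover have "(\<integral>\<omega>'. f w (ind t \<omega>') \<partial>P) = F w" for w
    using integral_distr [OF measurable_ind measurable_f_fixed, of t w]
    by (simp add: distr_ind F_def)
  ultimately show ?thesis by simp
qed

section \<open>Recursions for the expected losses\<close>

definition x :: "nat \<Rightarrow> real" where
  "x t = (\<integral>\<omega>. F (W t \<omega>) \<partial>P)"

lemma x_nonneg: "0 \<le> x t"
  by (simp add: x_def F_nonneg)

definition d2 :: "nat \<Rightarrow> nat \<Rightarrow> real" where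
  "d2 s t = (\<integral>\<omega>. (norm (W t \<omega> - W s \<omega>))\<^sup>2 \<partial>P)"

text \<open>The one-step inequality holds for every outcome. Both losses in it are taken at
  \<open>ind t\<close>, which is fresh for \<open>W t\<close> and \<open>W s\<close> alike, so
  integration gives \<open>x t\<close> and \<open>x s\<close>.\<close>

lemma d2_Suc_le:
  assumes "s \<le> t"
  shows "d2 s (Suc t) \<le> d2 s t - 2 * \<eta> * \<gamma> * x t + 2 * \<eta> / \<gamma> * x s"
proof -
  have int: "integrable P (\<lambda>\<omega>. (norm (W u \<omega> - W s \<omega>))\<^sup>2)" for u
    using AE_W_bounded by (intro integrable_dist_W) auto
  have "d2 s (Suc t) \<le> (\<integral>\<omega>. (norm (W t \<omega> - W s \<omega>))\<^sup>2 - 2 * \<eta> * \<gamma> * f (W t \<omega>) (ind t \<omega>)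
      + 2 * \<eta> / \<gamma> * f (W s \<omega>) (ind t \<omega>) \<partial>P)"
    unfolding d2_def
  proof (rule integral_mono)
    fix \<omega> assume "\<omega> \<in> space P"
    then show "(norm (W (Suc t) \<omega> - W s \<omega>))\<^sup>2 \<le> (norm (W t \<omega> - W s \<omega>))\<^sup>2
        - 2 * \<eta> * \<gamma> * f (W t \<omega>) (ind t \<omega>) + 2 * \<eta> / \<gamma> * f (W s \<omega>) (ind t \<omega>)"
      unfolding W_Suc f_def g_def
      using measurable_space [OF measurable_ind] eta gamma_pos spectral
      by (intro least_squares_step [OF _ _ \<gamma>_def]) auto
  qed (intro int Bochner_Integration.integrable_add Bochner_Integration.integrable_diff
      integrable_mult_right integrable_f_W)+
  also have "\<dots> = d2 s t - 2 * \<eta> * \<gamma> * x t + 2 * \<eta> / \<gamma> * x s"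
    using assms by (simp add: int integrable_f_W expectation_f_W d2_def x_def)
  finally show ?thesis .
qed

text \<open>Comparing with the iterate \<open>W s\<close> itself makes the initial distance vanish.\<close>

lemma suffix_sum_le:
  assumes "s \<le> T"
  shows "\<gamma>\<^sup>2 * (\<Sum>t=s..T. x t) \<le> real (Suc (T - s)) * x s"
proof -
  \<comment> \<open>Each step from \<open>s\<close> to \<open>T\<close> contributes one
    \<open>x s\<close>, hence the count \<open>Suc (T - s)\<close>; pulling out
    \<open>2 \<eta> / \<gamma>\<close> turns \<open>2 \<eta> \<gamma>\<close> into
    \<open>\<gamma>^2\<close>.\<close>
  have "d2 s (Suc T) \<le> 2 * \<eta> / \<gamma> * (real (Suc (T - s)) * x s - \<gamma>\<^sup>2 * (\<Sum>t=s..T. x t))"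
    using assms
  proof (induction T rule: dec_induct)
    case base
    have "d2 s s = 0" by (simp add: d2_def)
    then show ?case
      using d2_Suc_le [of s s] gamma_pos by (simp add: field_simps power2_eq_square)
  next
    case (step T)
    have "d2 s (Suc (Suc T)) \<le> d2 s (Suc T) + 2 * \<eta> / \<gamma> * (x s - \<gamma>\<^sup>2 * x (Suc T))"
      using d2_Suc_le [of s "Suc T"] step.hyps gamma_pos
      by (simp add: field_simps power2_eq_square)
    also have "\<dots> \<le> 2 * \<eta> / \<gamma> * (real (Suc (T - s)) * x s - \<gamma>\<^sup>2 * (\<Sum>t=s..T. x t))
        + 2 * \<eta> / \<gamma> * (x s - \<gamma>\<^sup>2 * x (Suc T))"
      using step.IH by simp
    also have "\<dots> = 2 * \<eta> / \<gamma> * (real (Suc (Suc T - s)) * x s - \<gamma>\<^sup>2 * (\<Sum>t=s..Suc T. x t))"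
      using step.hyps unfolding distrib_left [symmetric]
      by (simp add: Suc_diff_le algebra_simps)
    finally show ?case .
  qed
  moreover have "0 \<le> d2 s (Suc T)"
    by (simp add: d2_def)
  ultimately have "0 \<le> 2 * \<eta> / \<gamma> * (real (Suc (T - s)) * x s - \<gamma>\<^sup>2 * (\<Sum>t=s..T. x t))"
    by linarith
  then show ?thesis
    using eta gamma_pos by (simp add: zero_le_mult_iff zero_le_divide_iff)
qed

text \<open>The expected squared distance to \<open>w_star\<close> drops by at least
  \<open>4 \<eta> \<gamma> * x t\<close> in each step and stays nonnegative, so the drops
  telescope.\<close>

lemma sum_le: "4 * \<eta> * \<gamma> * (\<Sum>t\<le>T. x t) \<le> (norm (w0 - w_star))\<^sup>2"
proof -
  define e where "e t = (\<integral>\<omega>. (norm (W t \<omega> - w_star))\<^sup>2 \<partial>P)" for t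
  have int: "integrable P (\<lambda>\<omega>. (norm (W u \<omega> - w_star))\<^sup>2)" for u
    by (rule integrable_dist_W) auto
  have e_Suc: "e (Suc t) \<le> e t - 4 * \<eta> * \<gamma> * x t" for t
  proof -
    have "e (Suc t) \<le> (\<integral>\<omega>. (norm (W t \<omega> - w_star))\<^sup>2 - 4 * \<eta> * \<gamma> * f (W t \<omega>) (ind t \<omega>) \<partial>P)"
      unfolding e_def
    \<comment> \<open>Zero loss at \<open>w_star\<close> is known only almost surely, and so is the
      decrease.\<close>
    proof (rule integral_mono_AE)
      show "AE \<omega> in P. (norm (W (Suc t) \<omega> - w_star))\<^sup>2
          \<le> (norm (W t \<omega> - w_star))\<^sup>2 - 4 * \<eta> * \<gamma> * f (W t \<omega>) (ind t \<omega>)"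
        using AE_interpolation AE_space
        by eventually_elim
           (auto simp: W_Suc intro!: step_minimizer measurable_space [OF measurable_ind])
    qed (intro int Bochner_Integration.integrable_diff integrable_mult_right integrable_f_W)+
    also have "\<dots> = e t - 4 * \<eta> * \<gamma> * x t"
      by (simp add: int integrable_f_W expectation_f_W e_def x_def)
    finally show ?thesis .
  qed
  have "e (Suc T) \<le> e 0 - 4 * \<eta> * \<gamma> * (\<Sum>t\<le>T. x t)"
  proof (induction T)
    case 0
    then show ?case using e_Suc [of 0] by simp
  next
    case (Suc T)
    then show ?case using e_Suc [of "Suc T"] by (simp add: algebra_simps)
  qed
  moreover have "e 0 = (norm (w0 - w_star))\<^sup>2"
    by (simp add: e_def W_def P.prob_space)
  moreover have "0 \<le> e (Suc T)"
    by (simp add: e_def)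
  ultimately show ?thesis by linarith
qed

lemma last_iterate:
  assumes "T \<ge> 1"
  shows "x T \<le> exp 1 * (norm (w0 - w_star))\<^sup>2
    / (2 * \<eta> * (2 - \<eta> * \<beta>) * real T powr (1 - \<eta> * \<beta> * (1 - \<eta> * \<beta> / 4)))"
proof -
  have "x T \<le> exp 1 * (\<Sum>t\<le>T. x t) / real T powr \<gamma>\<^sup>2"
    using gamma_pos gamma_le_1 assms
    by (intro last_le_sum suffix_sum_le x_nonneg) (auto simp: power_le_one)
  also have "\<dots> \<le> exp 1 * ((norm (w0 - w_star))\<^sup>2 / (4 * \<eta> * \<gamma>)) / real T powr \<gamma>\<^sup>2"
    using sum_le [of T] eta gamma_pos
    by (intro divide_right_mono mult_left_mono) (auto simp: field_simps)
  also have "\<dots> = exp 1 * (norm (w0 - w_star))\<^sup>2 / (4 * \<eta> * \<gamma> * real T powr \<gamma>\<^sup>2)"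
    by simp
  also have "4 * \<eta> * \<gamma> = 2 * \<eta> * (2 - \<eta> * \<beta>)"
    by (simp add: \<gamma>_def algebra_simps)
  also have "\<gamma>\<^sup>2 = 1 - \<eta> * \<beta> * (1 - \<eta> * \<beta> / 4)"
    by (simp add: \<gamma>_def algebra_simps power2_eq_square)
  finally show ?thesis .
qed

end

theorem theorem12:
  fixes \<D> :: "'i measure"
    and n :: "'i \<Rightarrow> nat"
    and A :: "'i \<Rightarrow> nat \<Rightarrow> real ^ 'd"
    and b :: "'i \<Rightarrow> nat \<Rightarrow> real"
    and f :: "real ^ 'd \<Rightarrow> 'i \<Rightarrow> real"
    and fbar :: "real ^ 'd \<Rightarrow> real"
    and \<beta> :: real
    and w0 w_star :: "real ^ 'd"
    and P :: "'\<omega> measure"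
    and ind :: "nat \<Rightarrow> '\<omega> \<Rightarrow> 'i"
  assumes "prob_space \<D>"
    and "\<And>w i. f w i = least_squares (n i) (A i) (b i) w"
    and "\<beta> > 0"
    and "\<And>i. i \<in> space \<D> \<Longrightarrow> spectral_norm (gram (n i) (A i)) \<le> \<beta>"
    and "\<And>w. integrable \<D> (f w)"
    and "\<And>w. fbar w = (\<integral>i. f w i \<partial>\<D>)"
    and "fbar w_star = 0"
    and "prob_space P"
    and "prob_space.indep_vars P (\<lambda>_. \<D>) ind UNIV"
    and "\<And>t. distr P \<D> (ind t) = \<D>"
  shows "(\<forall>\<eta> T. 0 < \<eta> \<and> \<eta> < 2 / \<beta> \<and> T \<ge> 1 \<longrightarrow>
            integrable P (\<lambda>\<omega>. fbar (sgd f \<eta> w0 (\<lambda>t. ind t \<omega>) T)) \<and>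
            (\<integral>\<omega>. fbar (sgd f \<eta> w0 (\<lambda>t. ind t \<omega>) T) \<partial>P)
              \<le> exp 1 * (norm (w0 - w_star))\<^sup>2
                / (2 * \<eta> * (2 - \<eta> * \<beta>) * real T powr (1 - \<eta> * \<beta> * (1 - \<eta> * \<beta> / 4)))) \<and>
         (\<forall>T\<ge>1. (\<integral>\<omega>. fbar (sgd f (1 / \<beta>) w0 (\<lambda>t. ind t \<omega>) T) \<partial>P)
              \<le> exp 1 * \<beta> * (norm (w0 - w_star))\<^sup>2 / (2 * root 4 (real T)))"
proof -
  have f: "f = (\<lambda>w i. least_squares (n i) (A i) (b i) w)"
    using assms(2) by (simp add: fun_eq_iff)
  have main: "integrable P (\<lambda>\<omega>. fbar (sgd f \<eta> w0 (\<lambda>t. ind t \<omega>) T)) \<and>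
            (\<integral>\<omega>. fbar (sgd f \<eta> w0 (\<lambda>t. ind t \<omega>) T) \<partial>P)
              \<le> exp 1 * (norm (w0 - w_star))\<^sup>2
                / (2 * \<eta> * (2 - \<eta> * \<beta>) * real T powr (1 - \<eta> * \<beta> * (1 - \<eta> * \<beta> / 4)))"
    if "0 < \<eta>" "\<eta> < 2 / \<beta>" "T \<ge> 1" for \<eta> T
  proof -
    interpret P: prob_space P by fact
    interpret D: prob_space \<D> by fact
    interpret L: least_squares_sgd P \<D> n A b \<beta> \<eta> w0 w_star ind
      by unfold_locales (use assms that in \<open>auto simp: f\<close>)
    have [simp]: "L.f = f" "L.F = fbar"
      using assms(2,6) by (simp_all add: fun_eq_iff L.f_def L.F_def)
    show ?thesis
      using L.integrable_F_W [of T] L.last_iterate [OF \<open>T \<ge> 1\<close>] by (simp add: L.W_def L.x_def)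
  qed
  \<comment> \<open>At \<open>\<eta> = 1 / \<beta>\<close> the exponent is
    \<open>1 - 3/4 = 1/4\<close>, and \<open>2 * \<eta> * (2 - \<eta> * \<beta>)\<close> equals
    \<open>2 / \<beta>\<close>.\<close>
  moreover have "(\<integral>\<omega>. fbar (sgd f (1 / \<beta>) w0 (\<lambda>t. ind t \<omega>) T) \<partial>P)
      \<le> exp 1 * \<beta> * (norm (w0 - w_star))\<^sup>2 / (2 * root 4 (real T))" if "T \<ge> 1" for T
    using main [of "1 / \<beta>" T] that \<open>\<beta> > 0\<close>
    by (simp add: root_powr_inverse field_simps)
  ultimately show ?thesis by blast
qed

end
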